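(* Let $R$ be a commutative ring with unity and let $M$ be an $R$-module with $\operatorname{Spec}(M)\neq\emptyset$. Then the following statements are equivalent: (i) $\widetilde{\operatorname{Spec}(M)}$ is discrete. (ii) $\{(Q:M) \mid Q\in\operatorname{Spec}(M)\}$ is a set of incomparable prime ideals. (iii) $\widetilde{\operatorname{Spec}(M)}$ is a $T_1$-space. (iv) $\widetilde{\operatorname{Spec}(M)}$ is Hausdorff.
   Context: For a submodule $N$ of an $R$-module $M$, $(N:M)=\{r\in R : rM\subseteq N\}$. A proper submodule $P$ of $M$ is prime if whenever $rm\in P$ with $r\in R$, $m\in M$, then $m\in P$ or $r\in(P:M)$; in this case $(P:M)$ is a prime ideal of $R$. $\operatorname{Spec}(M)$ is the set of all prime submodules of $M$. A set of prime ideals is a set of incomparable prime ideals if no member of the set is contained in a different member of the set. A subset $T\subseteq R$ is multiplicatively closed if $1\in T$ and $xy\in T$ whenever $x,y\in T$. For a family $\mathcal{S}=\{S_i\}_{i\in I}$ of multiplicatively closed subsets of $R$, $\widetilde{V}(\mathcal{S})=\{P\in\operatorname{Spec}(M) \mid (P:M)\cap S_i\neq\emptyset \text{ for all } i\in I\}$. $\widetilde{\operatorname{Spec}(M)}$ denotes the set $\operatorname{Spec}(M)$ with the topology whose closed sets are exactly the sets $\widetilde{V}(\mathcal{S})$, $\mathcal{S}$ ranging over all families of multiplicatively closed subsets of $R$. A topological space $X$ is discrete if every subset is open; it is $T_1$ if for any distinct points $x,y\in X$ there is an open set $O$ with $x\in O$ and $y\notin O$; it is Hausdorff ($T_2$)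 if for any distinct points $x,y\in X$ there are open sets $O,O'$ with $x\in O$, $y\in O'$ and $O\cap O'=\emptyset$.
   Formalization: Statement (ii) is read for the family indexed by Q: (P:M) is not contained in (Q:M) for distinct P, Q in Spec(M), so Q ↦ (Q:M) is also injective; as a condition on the bare set it fails, e.g. for R = F_2, M = F_2^2, where the set is {0} but the space is not T_1. *)

theory Defs
  imports "HOL-Algebra.Module" "HOL-Algebra.Ideal" "HOL-Analysis.T1_Spaces"
begin

definition colon ::
    "('r, 'k) ring_scheme \<Rightarrow> ('r, 'm, 'l) module_scheme \<Rightarrow> 'm set \<Rightarrow> 'r set" where
  "colon R M N = {r \<in> carrier R. \<forall>m \<in> carrier M. r \<odot>\<^bsub>M\<^esub> m \<in> N}"

definition prime_submodule ::
    "('r, 'k) ring_scheme \<Rightarrow> ('r, 'm, 'l) module_scheme \<Rightarrow> 'm set \<Rightarrow> bool" where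
  "prime_submodule R M P \<longleftrightarrow>
     submodule P R M \<and> P \<noteq> carrier M \<and>
     (\<forall>r \<in> carrier R. \<forall>m \<in> carrier M. r \<odot>\<^bsub>M\<^esub> m \<in> P \<longrightarrow> m \<in> P \<or> r \<in> colon R M P)"

definition Spec :: "('r, 'k) ring_scheme \<Rightarrow> ('r, 'm, 'l) module_scheme \<Rightarrow> 'm set set" where
  "Spec R M = {P. prime_submodule R M P}"

text \<open>
  Incomparability is read for the family \<open>(F i)\<close>, \<open>i \<in> I\<close>: members with different indices are
  never contained in one another, so in particular \<open>F\<close> is injective on \<open>I\<close>. For
  \<open>F = colon R M\<close> and \<open>I = Spec R M\<close> it would not do to compare only different elements of the
  set \<open>F ` I\<close>: if \<open>M\<close> is a vector space of dimension at least 2, then all proper subspaces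
  are prime with colon ideal 0, so \<open>F ` I\<close> is a singleton, but the topology below is indiscrete on
  a set of more than one point.
\<close>

definition incomparable_primeideals ::
    "('r, 'k) ring_scheme \<Rightarrow> ('i \<Rightarrow> 'r set) \<Rightarrow> 'i set \<Rightarrow> bool" where
  "incomparable_primeideals R F I \<longleftrightarrow>
     (\<forall>i \<in> I. primeideal (F i) R) \<and>
     (\<forall>i \<in> I. \<forall>j \<in> I. i \<noteq> j \<longrightarrow> \<not> F i \<subseteq> F j)"

text \<open>
  A multiplicatively closed subset of \<open>R\<close> is a \<open>submonoid\<close> of the multiplicative structure of
  \<open>R\<close> (it may contain zero). The set \<open>Vtilde R M \<S>\<close> depends on a family only through
  its range, so families are represented by sets of subsets; the empty family is allowed.
\<close>

definition mult_closed_family :: "('r, 'k) ring_scheme \<Rightarrow> 'r set set \<Rightarrow> bool" where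
  "mult_closed_family R \<S> \<longleftrightarrow> (\<forall>S \<in> \<S>. submonoid S R)"

definition Vtilde ::
    "('r, 'k) ring_scheme \<Rightarrow> ('r, 'm, 'l) module_scheme \<Rightarrow> 'r set set \<Rightarrow> 'm set set" where
  "Vtilde R M \<S> = {P \<in> Spec R M. \<forall>S \<in> \<S>. colon R M P \<inter> S \<noteq> {}}"

definition Spec_tilde ::
    "('r, 'k) ring_scheme \<Rightarrow> ('r, 'm, 'l) module_scheme \<Rightarrow> 'm set topology" where
  "Spec_tilde R M =
     topology (\<lambda>U. U \<subseteq> Spec R M \<and>
                   (\<exists>\<S>. mult_closed_family R \<S> \<and> Spec R M - U = Vtilde R M \<S>))"

lemma colon_absorb:
  assumes "Module.module R M" "submodule P R M" "a \<in> colon R M P" "b \<in> carrier R"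
  shows "a \<otimes>\<^bsub>R\<^esub> b \<in> colon R M P" "b \<otimes>\<^bsub>R\<^esub> a \<in> colon R M P"
proof -
  interpret Module.module R M by fact
  have a: "a \<in> carrier R" using assms(3) by (simp add: colon_def)
  show "a \<otimes>\<^bsub>R\<^esub> b \<in> colon R M P"
    using assms(3,4) a by (auto simp: colon_def smult_assoc1)
  then show "b \<otimes>\<^bsub>R\<^esub> a \<in> colon R M P"
    using a assms(4) by (simp add: m_comm)
qed

lemma colon_prime:
  assumes "Module.module R M" "P \<in> Spec R M" "a \<in> carrier R" "b \<in> carrier R"
    "a \<otimes>\<^bsub>R\<^esub> b \<in> colon R M P"
  shows "a \<in> colon R M P \<or> b \<in> colon R M P"
proof (rule disjCI)
  interpret Module.module R M by fact
  assume "b \<notin> colon R M P"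
  then obtain m where m: "m \<in> carrier M" "b \<odot>\<^bsub>M\<^esub> m \<notin> P"
    using assms(4) by (auto simp: colon_def)
  have "a \<odot>\<^bsub>M\<^esub> (b \<odot>\<^bsub>M\<^esub> m) \<in> P"
    using assms(3-5) m(1) by (auto simp: colon_def smult_assoc1)
  then show "a \<in> colon R M P"
    using assms m by (auto simp: Spec_def prime_submodule_def)
qed

lemma submonoid_set_prod:
  assumes "cring R" "submonoid S R" "submonoid T R"
  shows "submonoid {s \<otimes>\<^bsub>R\<^esub> t |s t. s \<in> S \<and> t \<in> T} R"
proof -
  interpret cring R by fact
  interpret S: submonoid S R by fact
  interpret T: submonoid T R by fact
  have c: "s \<in> carrier R" if "s \<in> S \<or> s \<in> T" for s
    using that S.subset T.subset by blast
  show ?thesis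
  proof
    show "{s \<otimes>\<^bsub>R\<^esub> t |s t. s \<in> S \<and> t \<in> T} \<subseteq> carrier R" using c by auto
    show "\<one>\<^bsub>R\<^esub> \<in> {s \<otimes>\<^bsub>R\<^esub> t |s t. s \<in> S \<and> t \<in> T}"
      using S.one_closed T.one_closed l_one[OF one_closed, symmetric] by blast
    fix x y
    assume "x \<in> {s \<otimes>\<^bsub>R\<^esub> t |s t. s \<in> S \<and> t \<in> T}" "y \<in> {s \<otimes>\<^bsub>R\<^esub> t |s t. s \<in> S \<and> t \<in> T}"
    then obtain s t s' t' where *: "s \<in> S" "t \<in> T" "s' \<in> S" "t' \<in> T"
      "x = s \<otimes>\<^bsub>R\<^esub> t" "y = s' \<otimes>\<^bsub>R\<^esub> t'" by auto
    then have "x \<otimes>\<^bsub>R\<^esub> y = (s \<otimes>\<^bsub>R\<^esub> s') \<otimes>\<^bsub>R\<^esub> (t \<otimes>\<^bsub>R\<^esub> t')"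
      using c by (simp add: m_assoc m_lcomm)
    then show "x \<otimes>\<^bsub>R\<^esub> y \<in> {s \<otimes>\<^bsub>R\<^esub> t |s t. s \<in> S \<and> t \<in> T}"
      using * S.m_closed T.m_closed by blast
  qed
qed

lemma colon_meets_set_prod:
  assumes "Module.module R M" "P \<in> Spec R M" "submonoid S R" "submonoid T R"
  shows "colon R M P \<inter> {s \<otimes>\<^bsub>R\<^esub> t |s t. s \<in> S \<and> t \<in> T} \<noteq> {} \<longleftrightarrow>
         colon R M P \<inter> S \<noteq> {} \<or> colon R M P \<inter> T \<noteq> {}"
proof -
  interpret Module.module R M by fact
  interpret S: submonoid S R by fact
  interpret T: submonoid T R by fact
  have sub: "submodule P R M" using assms(2) by (simp add: Spec_def prime_submodule_def)
  have c: "s \<in> carrier R" if "s \<in> S \<or> s \<in> T" for s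
    using that S.subset T.subset by blast
  show ?thesis (is "?L \<longleftrightarrow> ?Q")
  proof
    assume ?L
    then obtain s t where "s \<in> S" "t \<in> T" "s \<otimes>\<^bsub>R\<^esub> t \<in> colon R M P" by auto
    then show ?Q using colon_prime[OF assms(1,2), of s t] c by blast
  next
    assume ?Q
    then show ?L
    proof
      assume "colon R M P \<inter> S \<noteq> {}"
      then obtain s where "s \<in> S" "s \<in> colon R M P" by auto
      with colon_absorb(1)[OF assms(1) sub _ R.one_closed, of s] T.one_closed show ?L by blast
    next
      assume "colon R M P \<inter> T \<noteq> {}"
      then obtain t where "t \<in> T" "t \<in> colon R M P" by auto
      with colon_absorb(2)[OF assms(1) sub _ R.one_closed, of t] S.one_closed show ?L by blast
    qed
  qed
qed

lemma istopology_Spec_tilde: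
  assumes "Module.module R M"
  shows "istopology (\<lambda>U. U \<subseteq> Spec R M \<and>
           (\<exists>\<S>. mult_closed_family R \<S> \<and> Spec R M - U = Vtilde R M \<S>))"
    (is "istopology ?open")
proof -
  interpret Module.module R M by fact
  have open_Int: "?open (U \<inter> U')" if U: "?open U" and U': "?open U'" for U U'
  proof -
    obtain \<S> where S: "mult_closed_family R \<S>" "Spec R M - U = Vtilde R M \<S>"
      using U by blast
    obtain \<T> where T: "mult_closed_family R \<T>" "Spec R M - U' = Vtilde R M \<T>"
      using U' by blast
    let ?prod = "\<lambda>S T. {s \<otimes>\<^bsub>R\<^esub> t |s t. s \<in> S \<and> t \<in> T}"
    let ?W = "{?prod S T |S T. S \<in> \<S> \<and> T \<in> \<T>}"
    have fam: "mult_closed_family R ?W"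
      using S(1) T(1) submonoid_set_prod[OF is_cring] by (fastforce simp: mult_closed_family_def)
    have "P \<in> Vtilde R M ?W \<longleftrightarrow> P \<in> Vtilde R M \<S> \<union> Vtilde R M \<T>" for P
    proof (cases "P \<in> Spec R M")
      case True
      have eq: "colon R M P \<inter> ?prod A B \<noteq> {} \<longleftrightarrow> colon R M P \<inter> A \<noteq> {} \<or> colon R M P \<inter> B \<noteq> {}"
        if "A \<in> \<S>" "B \<in> \<T>" for A B
        using colon_meets_set_prod[OF assms True] S(1) T(1) that
        by (simp add: mult_closed_family_def)
      have "P \<in> Vtilde R M ?W \<longleftrightarrow> (\<forall>A\<in>\<S>. \<forall>B\<in>\<T>. colon R M P \<inter> ?prod A B \<noteq> {})"
        unfolding Vtilde_def using True by blast
      also have "\<dots> \<longleftrightarrow> (\<forall>A\<in>\<S>. \<forall>B\<in>\<T>. colon R M P \<inter> A \<noteq> {} \<or> colon R M P \<inter> B \<noteq> {})"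
        using eq by simp
      also have "\<dots> \<longleftrightarrow> P \<in> Vtilde R M \<S> \<union> Vtilde R M \<T>"
        unfolding Vtilde_def using True by blast
      finally show ?thesis .
    qed (simp add: Vtilde_def)
    then have "Spec R M - (U \<inter> U') = Vtilde R M ?W"
      using S(2) T(2) by blast
    then show ?thesis using fam U by blast
  qed
  have open_Union: "?open (\<Union>\<U>)" if \<U>: "\<And>U. U \<in> \<U> \<Longrightarrow> ?open U" for \<U>
  proof -
    obtain f where f: "\<And>U. U \<in> \<U> \<Longrightarrow> mult_closed_family R (f U) \<and> Spec R M - U = Vtilde R M (f U)"
      using \<U> by metis
    have "mult_closed_family R (\<Union>(f ` \<U>))"
      using f by (auto simp: mult_closed_family_def)
    moreover have "P \<in> Spec R M - \<Union>\<U> \<longleftrightarrow> P \<in> Vtilde R M (\<Union>(f ` \<U>))" for P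
    proof (cases "P \<in> Spec R M")
      case True
      have "P \<notin> U \<longleftrightarrow> (\<forall>S \<in> f U. colon R M P \<inter> S \<noteq> {})" if "U \<in> \<U>" for U
      proof -
        have "P \<notin> U \<longleftrightarrow> P \<in> Vtilde R M (f U)" using f[OF that] True by blast
        then show ?thesis using True by (simp add: Vtilde_def)
      qed
      then show ?thesis using True by (simp add: Vtilde_def)
    qed (simp add: Vtilde_def)
    then have "Spec R M - \<Union>\<U> = Vtilde R M (\<Union>(f ` \<U>))" by blast
    moreover have "\<Union>\<U> \<subseteq> Spec R M" using \<U> by blast
    ultimately show ?thesis by blast
  qed
  show ?thesis
    unfolding istopology_def
  proof (rule conjI; (rule allI)+; (rule impI)+)
    show "?open (U \<inter> U')" if "?open U" "?open U'" for U U'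
      using that by (rule open_Int)
    show "?open (\<Union>\<U>)" if "\<forall>U \<in> \<U>. ?open U" for \<U>
      by (rule open_Union) (rule bspec[OF that])
  qed
qed

lemma openin_Spec_tilde:
  assumes "Module.module R M"
  shows "openin (Spec_tilde R M) U \<longleftrightarrow>
         U \<subseteq> Spec R M \<and> (\<exists>\<S>. mult_closed_family R \<S> \<and> Spec R M - U = Vtilde R M \<S>)"
  unfolding Spec_tilde_def topology_inverse'[OF istopology_Spec_tilde[OF assms]] ..

lemma topspace_Spec_tilde:
  assumes "Module.module R M"
  shows "topspace (Spec_tilde R M) = Spec R M"
proof -
  interpret Module.module R M by fact
  have "submonoid {\<one>\<^bsub>R\<^esub>} R" by unfold_locales auto
  moreover have "\<one>\<^bsub>R\<^esub> \<notin> colon R M P" if "P \<in> Spec R M" for P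
    using that submoduleE(1)[of P] by (auto simp: colon_def Spec_def prime_submodule_def)
  ultimately have "openin (Spec_tilde R M) (Spec R M)"
    unfolding openin_Spec_tilde[OF assms]
    by (intro conjI exI[of _ "{{\<one>\<^bsub>R\<^esub>}}"]) (auto simp: mult_closed_family_def Vtilde_def)
  then show ?thesis
    using openin_Spec_tilde[OF assms] by (metis openin_subset openin_topspace subset_antisym)
qed

lemma closedin_Spec_tilde:
  assumes "Module.module R M"
  shows "closedin (Spec_tilde R M) C \<longleftrightarrow> (\<exists>\<S>. mult_closed_family R \<S> \<and> C = Vtilde R M \<S>)"
proof -
  have "Vtilde R M \<S> \<subseteq> Spec R M" for \<S> by (auto simp: Vtilde_def)
  then show ?thesis
    unfolding closedin_def topspace_Spec_tilde[OF assms] openin_Spec_tilde[OF assms]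
    by (metis Diff_subset double_diff subset_refl)
qed

end

(* The topology is the Alexandrov topology of the preorder (Q:M) \<subseteq> (P:M): open sets are downward
   closed, because a multiplicatively closed set avoiding (P:M) avoids every smaller colon ideal, and
   the complement of the prime ideal (P:M) shows that the set of all Q below P is open. So T1 says
   that the preorder is equality, which is incomparability, and then every singleton is open. *)

theory Submission
  imports Defs
begin

text \<open>Absorption and primality are already known, which leaves the additive subgroup and
  properness. The result makes the complement of a colon ideal available as a multiplicatively
  closed set.\<close>

lemma primeideal_colon:
  assumes "Module.module R M" "P \<in> Spec R M"
  shows "primeideal (colon R M P) R"
proof -
  interpret Module.module R M by fact
  have sub: "submodule P R M" and neq: "P \<noteq> carrier M"
    using assms(2) by (auto simp: Spec_def prime_submodule_def)
  interpret P: submodule P R M by (fact sub)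
  have neg: "\<ominus>\<^bsub>R\<^esub> a \<in> colon R M P" if "a \<in> colon R M P" for a
  proof -
    have "a \<in> carrier R" using that by (simp add: colon_def)
    \<comment> \<open>Negation is multiplication by -1, so it is a case of absorption.\<close>
    then have "\<ominus>\<^bsub>R\<^esub> a = (\<ominus>\<^bsub>R\<^esub> \<one>\<^bsub>R\<^esub>) \<otimes>\<^bsub>R\<^esub> a" by (simp add: R.l_minus)
    then show ?thesis using colon_absorb(2)[OF assms(1) sub that] by simp
  qed
  have zero: "\<zero>\<^bsub>M\<^esub> \<in> P"
    using P.one_closed by simp
  have add: "a \<oplus>\<^bsub>R\<^esub> b \<in> colon R M P" if "a \<in> colon R M P" "b \<in> colon R M P" for a b
    using that submoduleE(5)[OF sub] by (auto simp: colon_def smult_l_distr)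
  have "subgroup (colon R M P) (add_monoid R)"
  proof (rule R.add.subgroupI)
    show "colon R M P \<subseteq> carrier R" by (auto simp: colon_def)
    show "colon R M P \<noteq> {}" using zero by (auto simp: colon_def intro!: exI[of _ "\<zero>\<^bsub>R\<^esub>"])
  qed (use neg add in \<open>auto simp: a_inv_def\<close>)
  then have "ideal (colon R M P) R"
    by (intro idealI R.ring_axioms colon_absorb[OF assms(1) sub]) auto
  moreover have "carrier R \<noteq> colon R M P"
  proof
    assume "carrier R = colon R M P"
    \<comment> \<open>If 1 lies in the colon ideal, then every \<open>m = 1 m\<close> lies in
      \<open>P\<close>, against \<open>P\<close> being proper.\<close>
    then have "\<one>\<^bsub>R\<^esub> \<in> colon R M P" using R.one_closed by blast
    then show False using neq submoduleE(1)[OF sub] by (auto simp: colon_def)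
  qed
  ultimately show ?thesis
    using R.is_cring colon_prime[OF assms] by (intro primeidealI)
qed

lemma submonoid_compl_primeideal:
  assumes "primeideal I R"
  shows "submonoid (carrier R - I) R"
proof -
  interpret primeideal I R by fact
  show ?thesis
    using I_prime I_notcarr one_imp_carrier by unfold_locales auto
qed

text \<open>Trades families of multiplicatively closed sets for inclusions of colon ideals, the form
  in which openness is used below.\<close>

lemma openin_Spec_tilde_iff_downward_closed:
  assumes "Module.module R M"
  shows "openin (Spec_tilde R M) U \<longleftrightarrow>
         U \<subseteq> Spec R M \<and>
         (\<forall>P \<in> U. \<forall>Q \<in> Spec R M. colon R M Q \<subseteq> colon R M P \<longrightarrow> Q \<in> U)"
    (is "?L \<longleftrightarrow> ?Q")
proof
  assume ?L
  then obtain \<S> where "U \<subseteq> Spec R M" "Spec R M - U = Vtilde R M \<S>"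
    unfolding openin_Spec_tilde[OF assms] by blast
  \<comment> \<open>A set \<open>S\<close> witnessing that \<open>P\<close> is in \<open>U\<close>
    also witnesses it for every \<open>Q\<close> with a smaller colon ideal.\<close>
  then have U: "P \<in> U \<longleftrightarrow> P \<in> Spec R M \<and> (\<exists>S \<in> \<S>. colon R M P \<inter> S = {})" for P
    unfolding Vtilde_def by blast
  show ?Q unfolding Ball_def subset_iff U by blast
next
  assume Q: ?Q
  \<comment> \<open>One set per point of \<open>U\<close>: a point lies outside
    \<open>Vtilde R M ?S\<close> iff its colon ideal is contained in that of some \<open>P\<close>
    in \<open>U\<close>, which by downward closure means that it lies in \<open>U\<close>. For empty
    \<open>U\<close> the family is empty.\<close>
  let ?S = "(\<lambda>P. carrier R - colon R M P) ` U"
  have "mult_closed_family R ?S"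
    using Q submonoid_compl_primeideal[OF primeideal_colon[OF assms]]
    by (auto simp: mult_closed_family_def)
  moreover have "colon R M P \<inter> (carrier R - colon R M Q) = {} \<longleftrightarrow> colon R M P \<subseteq> colon R M Q" for P Q
    by (auto simp: colon_def)
  then have "Spec R M - U = Vtilde R M ?S"
    using Q unfolding Vtilde_def by auto
  ultimately show ?L
    using Q unfolding openin_Spec_tilde[OF assms] by blast
qed

theorem theorem10:
  fixes R :: "('r, 'k) ring_scheme" and M :: "('r, 'm, 'l) module_scheme"
  assumes "Module.module R M" and "Spec R M \<noteq> {}"
  shows "(Spec_tilde R M = discrete_topology (Spec R M)
            \<longleftrightarrow> incomparable_primeideals R (colon R M) (Spec R M)) \<and>
         (incomparable_primeideals R (colon R M) (Spec R M)
            \<longleftrightarrow> t1_space (Spec_tilde R M)) \<and>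
         (t1_space (Spec_tilde R M) \<longleftrightarrow> Hausdorff_space (Spec_tilde R M))"
proof -
  note open_iff = openin_Spec_tilde_iff_downward_closed[OF assms(1)]
  \<comment> \<open>The cycle is discrete, Hausdorff, T1, incomparable, discrete.\<close>
  have "Hausdorff_space (Spec_tilde R M)" if "Spec_tilde R M = discrete_topology (Spec R M)"
    using that by (simp add: Hausdorff_space_discrete_topology)
  moreover have "t1_space (Spec_tilde R M)" if "Hausdorff_space (Spec_tilde R M)"
    using that by (rule Hausdorff_imp_t1_space)
  moreover have "incomparable_primeideals R (colon R M) (Spec R M)" if "t1_space (Spec_tilde R M)"
    unfolding incomparable_primeideals_def
  proof (intro conjI ballI impI notI)
    show "primeideal (colon R M P) R" if "P \<in> Spec R M" for P
      using assms(1) that by (rule primeideal_colon)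
    fix P Q
    assume *: "P \<in> Spec R M" "Q \<in> Spec R M" "P \<noteq> Q" "colon R M P \<subseteq> colon R M Q"
    \<comment> \<open>The larger point \<open>Q\<close> must be the one inside \<open>U\<close>,
      since downward closure then forces \<open>P\<close> into \<open>U\<close>.\<close>
    then obtain U where "openin (Spec_tilde R M) U" "Q \<in> U" "P \<notin> U"
      using \<open>t1_space (Spec_tilde R M)\<close>
      unfolding t1_space_def topspace_Spec_tilde[OF assms(1)] by metis
    then show False using * by (auto simp: open_iff)
  qed
  moreover have "Spec_tilde R M = discrete_topology (Spec R M)"
    if "incomparable_primeideals R (colon R M) (Spec R M)"
  proof -
    \<comment> \<open>By incomparability only \<open>P\<close> itself lies below \<open>P\<close>,
      so \<open>{P}\<close> is downward closed.\<close>
    have "openin (Spec_tilde R M) {P}" if "P \<in> Spec R M" for P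
      using that \<open>incomparable_primeideals R (colon R M) (Spec R M)\<close>
      by (auto simp: open_iff incomparable_primeideals_def)
    then show ?thesis
      using topspace_Spec_tilde[OF assms(1)] by (metis discrete_topology_unique)
  qed
  ultimately show ?thesis by blast
qed

end
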